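(* Let $n\ge 1$ and $l\geq 2$ be integers and let $H$ be a subgroup of $\mathrm{Sym}_n$. Then the monoid $S_{n,l}(H)$ is cancellative if and only if $H$ is semi-regular and abelian.
   Context: $\mathrm{Sym}_n$ is the symmetric group on $\{1,\dots,n\}$. For a subgroup $H$ of $\mathrm{Sym}_n$ and an integer $l\ge 2$, $S_{n,l}(H)$ is the monoid given by the presentation $$S_{n,l}(H)=\langle x_1,\dots ,x_n\mid x_{i_1}x_{i_2}\cdots x_{i_l} =x_{\sigma (i_1)} x_{\sigma (i_2)} \cdots x_{\sigma (i_l)},\ \sigma \in H,\ i_1,\ldots ,i_l \in \{1,\ldots ,n\}\rangle.$$ A subgroup $H$ of $\mathrm{Sym}_n$ is semi-regular if for every $i\in\{1,\dots,n\}$ the stabilizer $H_i=\{\sigma\in H\mid \sigma(i)=i\}$ is trivial. Cancellative means both left and right cancellative. *)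

theory Defs
  imports "HOL-Algebra.Sym_Groups" "HOL-Algebra.Divisibility"
begin

section \<open>Monoids given by a presentation\<close>

text \<open>
  The free monoid on a set \<open>X\<close> of letters is the set \<open>lists X\<close> of words, with concatenation.
  \<open>pres_cong X R\<close> is the least congruence on it containing the pairs in \<open>R\<close>.
\<close>

inductive_set pres_cong :: "'a set \<Rightarrow> ('a list \<times> 'a list) set \<Rightarrow> ('a list \<times> 'a list) set"
  for X R where
  rel: "(u, v) \<in> R \<Longrightarrow> u \<in> lists X \<Longrightarrow> v \<in> lists X \<Longrightarrow> (u, v) \<in> pres_cong X R"
| refl: "u \<in> lists X \<Longrightarrow> (u, u) \<in> pres_cong X R"
| sym: "(u, v) \<in> pres_cong X R \<Longrightarrow> (v, u) \<in> pres_cong X R"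
| trans: "(u, v) \<in> pres_cong X R \<Longrightarrow> (v, w) \<in> pres_cong X R \<Longrightarrow> (u, w) \<in> pres_cong X R"
| mult: "(u, v) \<in> pres_cong X R \<Longrightarrow> (u', v') \<in> pres_cong X R
          \<Longrightarrow> (u @ u', v @ v') \<in> pres_cong X R"

text \<open>
  The union in \<open>mult\<close> ranges over representatives, all of which give the same class
  (see \<open>presented_monoid_mult\<close> below).
\<close>

definition presented_monoid ::
    "'a set \<Rightarrow> ('a list \<times> 'a list) set \<Rightarrow> 'a list set monoid" where
  "presented_monoid X R =
    \<lparr> carrier = lists X // pres_cong X R,
      mult = (\<lambda>A B. \<Union>a\<in>A. \<Union>b\<in>B. pres_cong X R `` {a @ b}),
      one = pres_cong X R `` {[]} \<rparr>"

lemma pres_cong_words: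
  "(u, v) \<in> pres_cong X R \<Longrightarrow> u \<in> lists X \<and> v \<in> lists X"
  by (induction rule: pres_cong.induct) auto

lemma equiv_pres_cong: "equiv (lists X) (pres_cong X R)"
proof (rule equivI)
  show "pres_cong X R \<subseteq> lists X \<times> lists X" by (clarify, frule pres_cong_words, blast)
  show "refl_on (lists X) (pres_cong X R)"
    by (intro refl_onI) (auto intro: pres_cong.refl)
  show "sym (pres_cong X R)" by (auto intro: symI pres_cong.sym)
  show "trans (pres_cong X R)" by (blast intro: transI pres_cong.trans)
qed

lemma presented_monoid_mult:
  assumes "u \<in> lists X" "v \<in> lists X"
  shows "(pres_cong X R `` {u}) \<otimes>\<^bsub>presented_monoid X R\<^esub> (pres_cong X R `` {v})
         = pres_cong X R `` {u @ v}"
proof -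
  have "(\<lambda>a b. pres_cong X R `` {a @ b}) respects2 pres_cong X R"
    by (intro congruent2I' equiv_class_eq[OF equiv_pres_cong] pres_cong.mult)
  then show ?thesis
    unfolding presented_monoid_def
    using UN_equiv_class2[OF equiv_pres_cong equiv_pres_cong _ assms] by simp
qed

lemma monoid_presented_monoid: "monoid (presented_monoid X R)"
proof -
  have carr: "carrier (presented_monoid X R) = (\<lambda>u. pres_cong X R `` {u}) ` lists X"
    by (auto simp: presented_monoid_def quotient_def)
  have one: "\<one>\<^bsub>presented_monoid X R\<^esub> = pres_cong X R `` {[]}"
    by (simp add: presented_monoid_def)
  have closed: "u @ v \<in> lists X" if "u \<in> lists X" "v \<in> lists X" for u v
    using that by simp
  have nil: "[] \<in> lists X" by simp
  show ?thesis
    by (rule monoidI; unfold carr one)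
      ((elim imageE)?;
        (simp only: presented_monoid_mult closed nil append_assoc append_Nil append_Nil2)?;
        (intro imageI closed nil; assumption)?)+
qed

section \<open>The monoids $S_{n,l}(H)$ and semi-regular permutation groups\<close>

text \<open>The letter \<open>i\<close> stands for the generator $x_i$.\<close>

definition S_relations ::
    "nat \<Rightarrow> nat \<Rightarrow> (nat \<Rightarrow> nat) set \<Rightarrow> (nat list \<times> nat list) set" where
  "S_relations n l H = {(w, map \<sigma> w) |w \<sigma>. \<sigma> \<in> H \<and> w \<in> lists {1..n} \<and> length w = l}"

definition S_monoid :: "nat \<Rightarrow> nat \<Rightarrow> (nat \<Rightarrow> nat) set \<Rightarrow> nat list set monoid" where
  "S_monoid n l H = presented_monoid {1..n} (S_relations n l H)"

definition semi_regular :: "nat \<Rightarrow> (nat \<Rightarrow> nat) set \<Rightarrow> bool" where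
  "semi_regular n H \<longleftrightarrow> (\<forall>i\<in>{1..n}. {\<sigma> \<in> H. \<sigma> i = i} = {id})"

end

theory Submission
  imports Defs
begin

text \<open>
  The relations preserve length and only relate words of length \<open>l\<close>, so a word shorter than \<open>l\<close> is
  congruent to itself only.  Cancelling therefore turns congruences between long words into
  equalities between short ones, and this makes \<open>H\<close> semi-regular and abelian:
  if \<open>\<sigma>\<close> fixes \<open>i\<close>, then \<open>i\<^sup>l\<^sup>-\<^sup>1 j\<close> is congruent to \<open>i\<^sup>l\<^sup>-\<^sup>1 \<sigma>(j)\<close>, so \<open>\<sigma>\<close> fixes every \<open>j\<close>;
  and on a word of length \<open>l + 1\<close> one can apply \<open>\<tau>\<close> to the first \<open>l\<close> letters and \<open>\<sigma>\<close> to the last \<open>l\<close>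
  in either order, with results that agree at both ends and differ between them by \<open>\<sigma>\<tau>\<close> versus \<open>\<tau>\<sigma>\<close>
  (\<open>fixed_point_imp_pointwise_fixed\<close>, \<open>cancel_imp_commute\<close>).

  Conversely, let \<open>H\<close> be abelian.  The moves at different windows of \<open>l\<close> consecutive letters then
  commute, so a chain of moves may be sorted: first a single move at the leftmost window, then the
  moves that do not touch the first letter.  The relation \<open>slide\<close> describes congruence in this
  sorted form, by recursion on the word; it agrees with the congruence by \<open>slide_imp_pres_cong\<close>
  and \<open>pres_cong_imp_slide\<close>.  If the two words start with the same letter
  and \<open>H\<close> is semi-regular, the move at the leftmost window must be the identity, and the rest of
  the chain shows that the tails are congruent.  Since the set of relations is invariant under reversing
  all words, left cancellation gives right cancellation.
\<close>

section \<open>Cancellation in presented monoids\<close>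

text \<open>Computations with classes reduce to computations with words here once and for all.\<close>

lemma monoid_cancel_presented_monoid_iff:
  "monoid_cancel (presented_monoid X R) \<longleftrightarrow>
     (\<forall>u\<in>lists X. \<forall>v\<in>lists X. \<forall>w\<in>lists X.
        ((w @ u, w @ v) \<in> pres_cong X R \<longrightarrow> (u, v) \<in> pres_cong X R) \<and>
        ((u @ w, v @ w) \<in> pres_cong X R \<longrightarrow> (u, v) \<in> pres_cong X R))"
  (is "?L \<longleftrightarrow> ?R")
proof -
  let ?M = "presented_monoid X R" and ?c = "\<lambda>u. pres_cong X R `` {u}"
  have carr: "carrier ?M = ?c ` lists X"
    by (auto simp: presented_monoid_def quotient_def)
  have eq: "?c u = ?c v \<longleftrightarrow> (u, v) \<in> pres_cong X R" if "u \<in> lists X" "v \<in> lists X" for u v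
    using that by (simp add: eq_equiv_class_iff[OF equiv_pres_cong])
  have app: "u @ v \<in> lists X" if "u \<in> lists X" "v \<in> lists X" for u v
    using that by simp
  have L: "?L \<longleftrightarrow> (\<forall>A\<in>carrier ?M. \<forall>B\<in>carrier ?M. \<forall>C\<in>carrier ?M.
      (C \<otimes>\<^bsub>?M\<^esub> A = C \<otimes>\<^bsub>?M\<^esub> B \<longrightarrow> A = B) \<and> (A \<otimes>\<^bsub>?M\<^esub> C = B \<otimes>\<^bsub>?M\<^esub> C \<longrightarrow> A = B))"
    using monoid_presented_monoid[of X R]
    unfolding monoid_cancel_def monoid_cancel_axioms_def by blast
  show ?thesis
    unfolding L carr ball_simps
    by (intro ball_cong HOL.refl) (simp only: presented_monoid_mult eq app)
qed

lemma presented_monoid_cancelD: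
  assumes "monoid_cancel (presented_monoid X R)"
  shows "(w @ u, w @ v) \<in> pres_cong X R \<Longrightarrow> (u, v) \<in> pres_cong X R"
    and "(u @ w, v @ w) \<in> pres_cong X R \<Longrightarrow> (u, v) \<in> pres_cong X R"
proof -
  note iff = monoid_cancel_presented_monoid_iff[THEN iffD1, OF assms, rule_format]
  show "(u, v) \<in> pres_cong X R" if "(w @ u, w @ v) \<in> pres_cong X R"
    using pres_cong_words[OF that] iff[of u v w] that by simp
  show "(u, v) \<in> pres_cong X R" if "(u @ w, v @ w) \<in> pres_cong X R"
    using pres_cong_words[OF that] iff[of u v w] that by simp
qed

lemma pres_cong_rev:
  assumes "(u, v) \<in> pres_cong X R" and "\<And>u v. (u, v) \<in> R \<Longrightarrow> (rev u, rev v) \<in> R"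
  shows "(rev u, rev v) \<in> pres_cong X R"
  using assms(1)
proof (induction rule: pres_cong.induct)
  case (rel u v)
  then show ?case by (intro pres_cong.rel assms(2)) auto
next
  case (refl u)
  then show ?case by (intro pres_cong.refl) auto
next
  case (sym u v)
  then show ?case by (blast intro: pres_cong.sym)
next
  case (trans u v w)
  then show ?case by (blast intro: pres_cong.trans)
next
  case (mult u v u' v')
  then show ?case by (simp add: pres_cong.mult)
qed

text \<open>No relation can be applied inside a word shorter than all the words in the relations.\<close>

lemma pres_cong_short:
  assumes "(u, v) \<in> pres_cong X R"
    and "\<And>u v. (u, v) \<in> R \<Longrightarrow> length u = l \<and> length v = l"
  shows "length u = length v \<and> (length u < l \<longrightarrow> u = v)"
  using assms(1)
proof (induction rule: pres_cong.induct)
  case (rel u v)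
  then show ?case using assms(2)[of u v] by simp
next
  case (sym u v)
  then show ?case by metis
next
  case (trans u v w)
  then show ?case by metis
next
  case (mult u v u' v')
  then show ?case by (metis add_lessD1 add.commute length_append)
qed simp

section \<open>Moves sorted from left to right\<close>

definition map_prefix :: "nat \<Rightarrow> ('a \<Rightarrow> 'a) \<Rightarrow> 'a list \<Rightarrow> 'a list" where
  "map_prefix k \<sigma> u = map \<sigma> (take k u) @ drop k u"

lemma length_map_prefix [simp]: "length (map_prefix k \<sigma> u) = length u"
  by (simp add: map_prefix_def)

lemma map_prefix_Cons:
  "map_prefix k \<sigma> (a # u) = (if k = 0 then a # u else \<sigma> a # map_prefix (k - 1) \<sigma> u)"
  by (cases k) (auto simp: map_prefix_def)

lemma map_prefix_id [simp]: "map_prefix k id u = u"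
  by (simp add: map_prefix_def)

lemma map_prefix_map_prefix: "map_prefix k \<tau> (map_prefix k \<sigma> u) = map_prefix k (\<tau> \<circ> \<sigma>) u"
proof (induction u arbitrary: k)
  case Nil
  then show ?case by (simp add: map_prefix_def)
qed (simp add: map_prefix_Cons)

lemma map_prefix_commute:
  assumes "\<sigma> \<circ> \<tau> = \<tau> \<circ> \<sigma>"
  shows "map_prefix j \<sigma> (map_prefix k \<tau> u) = map_prefix k \<tau> (map_prefix j \<sigma> u)"
proof (induction u arbitrary: j k)
  case Nil
  then show ?case by (simp add: map_prefix_def)
next
  case (Cons a u)
  then show ?case using fun_cong[OF assms, of a] by (simp add: map_prefix_Cons)
qed

lemma map_prefix_append: "k \<le> length u \<Longrightarrow> map_prefix k \<sigma> (u @ w) = map_prefix k \<sigma> u @ w"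
  by (simp add: map_prefix_def)

lemma map_prefix_long: "length u \<le> k \<Longrightarrow> map_prefix k \<sigma> u = map \<sigma> u"
  by (simp add: map_prefix_def)

lemma map_prefix_in_lists: "u \<in> lists X \<Longrightarrow> \<sigma> ` X \<subseteq> X \<Longrightarrow> map_prefix k \<sigma> u \<in> lists X"
  by (auto simp: map_prefix_def in_lists_conv_set dest: in_set_takeD in_set_dropD)

text \<open>
  In \<open>step\<close>, the element \<open>\<sigma>\<close> acts on the window formed by the letter \<open>a\<close> and the next \<open>l - 1\<close>
  letters; after that \<open>a\<close> has its final value and the remaining moves concern the tail.
\<close>

inductive slide :: "('a \<Rightarrow> 'a) set \<Rightarrow> nat \<Rightarrow> 'a list \<Rightarrow> 'a list \<Rightarrow> bool" for H l where
  short: "length u < l \<Longrightarrow> slide H l u u"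
| step: "\<sigma> \<in> H \<Longrightarrow> l \<le> Suc (length u) \<Longrightarrow> slide H l (map_prefix (l - 1) \<sigma> u) v
           \<Longrightarrow> slide H l (a # u) (\<sigma> a # v)"

lemma slide_length: "slide H l u v \<Longrightarrow> length u = length v"
  by (induction rule: slide.induct) auto

lemma slide_short: "slide H l u v \<Longrightarrow> length u < l \<Longrightarrow> u = v"
  by (erule slide.cases) auto

lemma slide_ConsE:
  assumes "slide H l (a # u) w" and "l \<le> Suc (length u)"
  obtains \<sigma> v where "\<sigma> \<in> H" "w = \<sigma> a # v" "slide H l (map_prefix (l - 1) \<sigma> u) v"
  using assms by (cases rule: slide.cases) auto

locale abelian_bijections =
  fixes H :: "('a \<Rightarrow> 'a) set" and l :: nat
  assumes id_mem: "id \<in> H"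
    and comp_mem: "\<sigma> \<in> H \<Longrightarrow> \<tau> \<in> H \<Longrightarrow> \<sigma> \<circ> \<tau> \<in> H"
    and inverse_mem: "\<sigma> \<in> H \<Longrightarrow> \<exists>\<tau>\<in>H. \<tau> \<circ> \<sigma> = id"
    and commute: "\<sigma> \<in> H \<Longrightarrow> \<tau> \<in> H \<Longrightarrow> \<sigma> \<circ> \<tau> = \<tau> \<circ> \<sigma>"
    and l_pos: "0 < l"
begin

lemma slide_refl: "slide H l u u"
proof (induction u)
  case Nil
  show ?case using l_pos by (intro slide.short) simp
next
  case (Cons a u)
  show ?case
  proof (cases "length (a # u) < l")
    case False
    then show ?thesis using slide.step[OF id_mem, of l u u a] Cons by simp
  qed (rule slide.short)
qed

text \<open>
  Acting on the letters at arbitrary positions, even on fewer than \<open>l\<close> of them, commutes with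
  all moves.  This is the only use of commutativity, and what allows moves to be reordered.
\<close>

lemma slide_map_prefix:
  assumes "slide H l u v" and "\<tau> \<in> H"
  shows "slide H l (map_prefix k \<tau> u) (map_prefix k \<tau> v)"
  using assms(1)
proof (induction arbitrary: k rule: slide.induct)
  case (short u)
  show ?case by (rule slide_refl)
next
  case (step \<sigma> u v a)
  have tail: "slide H l (map_prefix (l - 1) \<sigma> (map_prefix j \<tau> u)) (map_prefix j \<tau> v)" for j
    using step.IH[of j] map_prefix_commute[OF commute[OF \<open>\<tau> \<in> H\<close> \<open>\<sigma> \<in> H\<close>], of j "l - 1" u]
    by simp
  have "\<tau> (\<sigma> a) = \<sigma> (\<tau> a)"
    using fun_cong[OF commute[OF \<open>\<tau> \<in> H\<close> \<open>\<sigma> \<in> H\<close>], of a] by simp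
  then show ?case
    using slide.step[OF \<open>\<sigma> \<in> H\<close> _ tail, of "k - 1" "\<tau> a"] slide.step[OF step.hyps, of a] step.hyps(2)
    by (simp add: map_prefix_Cons)
qed

text \<open>
  The inverse of the first move is itself the first move of the reverse transformation, after it
  has been carried past the moves on the tail.
\<close>

lemma slide_sym: "slide H l u v \<Longrightarrow> slide H l v u"
proof (induction rule: slide.induct)
  case (short u)
  then show ?case by (rule slide.short)
next
  case (step \<sigma> u v a)
  obtain \<tau> where \<tau>: "\<tau> \<in> H" "\<tau> \<circ> \<sigma> = id" using inverse_mem step.hyps by blast
  have "slide H l (map_prefix (l - 1) \<tau> v) u"
    using slide_map_prefix[OF step.IH \<tau>(1), of "l - 1"] \<tau>(2) by (simp add: map_prefix_map_prefix)
  moreover have "l \<le> Suc (length v)" using step.hyps slide_length by fastforce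
  ultimately show ?case using slide.step[OF \<tau>(1), of l v u "\<sigma> a"] fun_cong[OF \<tau>(2), of a] by simp
qed

text \<open>
  The second leftmost move is carried past the moves of the first chain on the tail and merged
  with the first leftmost move.  The first tail thereby changes by a move of its own, so the
  induction is on the length of the word and not on the derivation.
\<close>

lemma slide_trans: "slide H l u v \<Longrightarrow> slide H l v w \<Longrightarrow> slide H l u w"
proof (induction "length u" arbitrary: u v w)
  case 0
  then show ?case using slide_short l_pos by fastforce
next
  case (Suc m)
  show ?case
  proof (cases "length u < l")
    case True
    then show ?thesis using slide_short Suc.prems by metis
  next
    case False
    obtain a u' where u: "u = a # u'" using Suc.hyps by (cases u) auto
    with False have long: "l \<le> Suc (length u')" by simp
    obtain \<sigma> v' where \<sigma>: "\<sigma> \<in> H" "v = \<sigma> a # v'" "slide H l (map_prefix (l - 1) \<sigma> u') v'"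
      using slide_ConsE[OF _ long] Suc.prems u by metis
    then have "l \<le> Suc (length v')" using slide_length long by fastforce
    then obtain \<tau> w' where
      \<tau>: "\<tau> \<in> H" "w = \<tau> (\<sigma> a) # w'" "slide H l (map_prefix (l - 1) \<tau> v') w'"
      using slide_ConsE Suc.prems \<sigma>(2) by metis
    have "slide H l (map_prefix (l - 1) (\<tau> \<circ> \<sigma>) u') w'"
      using slide_map_prefix[OF \<sigma>(3) \<tau>(1), of "l - 1"] \<tau>(3) Suc.hyps
      by (auto simp: map_prefix_map_prefix u intro: Suc.hyps(1))
    from slide.step[OF comp_mem[OF \<tau>(1) \<sigma>(1)] long this, of a]
    show ?thesis using u \<tau>(2) by simp
  qed
qed

lemma slide_append_left: "slide H l u v \<Longrightarrow> slide H l (w @ u) (w @ v)"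
proof (induction w)
  case (Cons a w)
  show ?case
  proof (cases "length (a # w @ u) < l")
    case True
    then show ?thesis using slide_short[OF Cons.prems] slide_refl by simp
  next
    case False
    then show ?thesis using slide.step[OF id_mem, of l "w @ u" "w @ v" a] Cons by simp
  qed
qed simp

lemma slide_append_right: "slide H l u v \<Longrightarrow> slide H l (u @ w) (v @ w)"
proof (induction rule: slide.induct)
  case (short u)
  show ?case by (rule slide_refl)
next
  case (step \<sigma> u v a)
  then show ?case
    using slide.step[OF step.hyps(1), of l "u @ w" "v @ w" a] by (simp add: map_prefix_append)
qed

lemma slide_map: "\<sigma> \<in> H \<Longrightarrow> length u = l \<Longrightarrow> slide H l u (map \<sigma> u)"
  using slide.step[of \<sigma> H l "tl u" "map \<sigma> (tl u)" "hd u"] slide_refl l_pos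
  by (cases u) (simp_all add: map_prefix_long)

end

section \<open>Congruence in \<open>S_monoid\<close>\<close>

lemma S_relations_rev:
  "(u, v) \<in> S_relations n l H \<Longrightarrow> (rev u, rev v) \<in> S_relations n l H"
  unfolding S_relations_def by (auto simp: rev_map intro!: exI[of _ "rev u"])

lemma S_relations_length:
  "(u, v) \<in> S_relations n l H \<Longrightarrow> length u = l \<and> length v = l"
  unfolding S_relations_def by auto

lemma pres_cong_window:
  assumes "\<sigma> \<in> H" "\<sigma> ` {1..n} \<subseteq> {1..n}" "p \<in> lists {1..n}" "w \<in> lists {1..n}" "q \<in> lists {1..n}"
    and "length w = l"
  shows "(p @ w @ q, p @ map \<sigma> w @ q) \<in> pres_cong {1..n} (S_relations n l H)"
proof -
  have "map \<sigma> w \<in> lists {1..n}"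
    using assms(2,4) by (metis image_mono in_lists_conv_set list.set_map subset_iff)
  then have "(w, map \<sigma> w) \<in> pres_cong {1..n} (S_relations n l H)"
    using assms by (intro pres_cong.rel) (auto simp: S_relations_def)
  with assms show ?thesis by (intro pres_cong.mult pres_cong.refl)
qed

lemma slide_imp_pres_cong:
  assumes "slide H l u v" and "u \<in> lists {1..n}"
    and "\<And>\<sigma>. \<sigma> \<in> H \<Longrightarrow> \<sigma> ` {1..n} \<subseteq> {1..n}" and "0 < l"
  shows "(u, v) \<in> pres_cong {1..n} (S_relations n l H)"
  using assms(1,2)
proof (induction rule: slide.induct)
  case (short u)
  then show ?case by (intro pres_cong.refl)
next
  case (step \<sigma> u v a)
  note \<sigma> = \<open>\<sigma> \<in> H\<close> assms(3)[OF \<open>\<sigma> \<in> H\<close>]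
  have parts: "take (l - 1) u \<in> lists {1..n}" "drop (l - 1) u \<in> lists {1..n}" "a \<in> {1..n}"
    using step.prems by (auto dest: in_set_takeD in_set_dropD)
  have "length (a # take (l - 1) u) = l"
    using step.hyps(2) \<open>0 < l\<close> by simp
  then have "(a # u, \<sigma> a # map_prefix (l - 1) \<sigma> u) \<in> pres_cong {1..n} (S_relations n l H)"
    using pres_cong_window[OF \<sigma>, of "[]" "a # take (l - 1) u" "drop (l - 1) u" l]
      parts by (simp add: map_prefix_def)
  moreover have "([\<sigma> a] @ map_prefix (l - 1) \<sigma> u, [\<sigma> a] @ v)
      \<in> pres_cong {1..n} (S_relations n l H)"
    using step.prems \<sigma>(2) parts(3)
    by (intro pres_cong.mult pres_cong.refl step.IH map_prefix_in_lists) (auto simp del: atLeastAtMost_iff)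
  ultimately show ?case by (auto intro: pres_cong.trans)
qed

text \<open>
  The relation \<open>slide\<close> is a congruence when \<open>H\<close> is abelian, and it contains the defining relations.
\<close>

lemma pres_cong_imp_slide:
  assumes "abelian_bijections H l" and "(u, v) \<in> pres_cong X (S_relations n l H)"
  shows "slide H l u v"
proof -
  interpret abelian_bijections H l by fact
  from assms(2) show ?thesis
  proof (induction rule: pres_cong.induct)
    case (rel u v)
    then obtain \<sigma> where "\<sigma> \<in> H" "length u = l" "v = map \<sigma> u"
      unfolding S_relations_def by blast
    then show ?case using slide_map by blast
  next
    case (mult u v u' v')
    then show ?case using slide_append_left slide_append_right slide_trans by blast
  qed (blast intro: slide_refl slide_sym slide_trans)+
qed

section \<open>Semi-regular abelian groups give cancellative monoids\<close>

text \<open>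
  In sorted form, congruence of two words with the same first letter \<open>a\<close> begins with a move that
  fixes \<open>a\<close>.  By semi-regularity this move is the identity, so what remains relates the tails.
\<close>

lemma pres_cong_left_cancel:
  assumes "abelian_bijections H l"
    and maps: "\<And>\<sigma>. \<sigma> \<in> H \<Longrightarrow> \<sigma> ` {1..n} \<subseteq> {1..n}"
    and free: "\<And>\<sigma> i. \<sigma> \<in> H \<Longrightarrow> i \<in> {1..n} \<Longrightarrow> \<sigma> i = i \<Longrightarrow> \<sigma> = id"
    and "(w @ u, w @ v) \<in> pres_cong {1..n} (S_relations n l H)"
  shows "(u, v) \<in> pres_cong {1..n} (S_relations n l H)"
  using assms(4)
proof (induction w)
  case (Cons a w)
  interpret abelian_bijections H l by fact
  have words: "a \<in> {1..n}" "w @ u \<in> lists {1..n}"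
    using pres_cong_words[OF Cons.prems] by auto
  have "slide H l (a # w @ u) (a # w @ v)"
    using pres_cong_imp_slide[OF assms(1) Cons.prems] by simp
  then have "slide H l (w @ u) (w @ v)"
  proof (cases rule: slide.cases)
    case short
    then show ?thesis by (simp add: slide_refl)
  next
    case (step \<sigma>)
    then show ?thesis using free[of \<sigma> a] words by simp
  qed
  then have "(w @ u, w @ v) \<in> pres_cong {1..n} (S_relations n l H)"
    using slide_imp_pres_cong words(2) maps l_pos by blast
  then show ?case by (rule Cons.IH)
qed simp

lemma pres_cong_right_cancel:
  assumes "abelian_bijections H l"
    and "\<And>\<sigma>. \<sigma> \<in> H \<Longrightarrow> \<sigma> ` {1..n} \<subseteq> {1..n}"
    and "\<And>\<sigma> i. \<sigma> \<in> H \<Longrightarrow> i \<in> {1..n} \<Longrightarrow> \<sigma> i = i \<Longrightarrow> \<sigma> = id"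
    and "(u @ w, v @ w) \<in> pres_cong {1..n} (S_relations n l H)"
  shows "(u, v) \<in> pres_cong {1..n} (S_relations n l H)"
proof -
  have "(rev w @ rev u, rev w @ rev v) \<in> pres_cong {1..n} (S_relations n l H)"
    using pres_cong_rev[OF assms(4) S_relations_rev] by simp
  from pres_cong_left_cancel[OF assms(1-3) this]
  have "(rev u, rev v) \<in> pres_cong {1..n} (S_relations n l H)" .
  from pres_cong_rev[OF this S_relations_rev] show ?thesis by simp
qed

section \<open>Cancellation makes the group semi-regular and abelian\<close>

text \<open>
  If \<open>\<sigma>\<close> fixes \<open>i\<close>, applying it to \<open>l - 1\<close> letters \<open>i\<close> followed by \<open>j\<close> changes only the last letter.
  After cancelling the letters \<open>i\<close>, the one-letter words \<open>j\<close> and \<open>\<sigma>(j)\<close> are congruent; as \<open>l \<ge> 2\<close>,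
  they are equal.
\<close>

lemma fixed_point_imp_pointwise_fixed:
  assumes cancel: "monoid_cancel (S_monoid n l H)" and "2 \<le> l"
    and \<sigma>: "\<sigma> \<in> H" "\<sigma> ` {1..n} \<subseteq> {1..n}"
    and ij: "i \<in> {1..n}" "\<sigma> i = i" "j \<in> {1..n}"
  shows "\<sigma> j = j"
proof -
  let ?w = "replicate (l - 1) i"
  have w: "?w \<in> lists {1..n}" "[j] \<in> lists {1..n}" "[\<sigma> j] \<in> lists {1..n}"
    using ij(1,3) image_subset_iff[THEN iffD1, OF \<sigma>(2)] by (simp_all add: in_lists_conv_set)
  have "(?w @ [j], ?w @ [\<sigma> j]) \<in> pres_cong {1..n} (S_relations n l H)"
    using pres_cong_window[OF \<sigma>, of "[]" "?w @ [j]" "[]" l] w ij(2) \<open>2 \<le> l\<close> by simp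
  then have "([j], [\<sigma> j]) \<in> pres_cong {1..n} (S_relations n l H)"
    by (rule presented_monoid_cancelD(1)[OF cancel[unfolded S_monoid_def]])
  with pres_cong_short[OF this S_relations_length] show ?thesis using \<open>2 \<le> l\<close> by simp
qed

text \<open>
  Take the word \<open>j u j\<close> of length \<open>l + 1\<close>, with every letter equal to \<open>j\<close>.  Applying \<open>\<tau>\<close> to its first
  \<open>l\<close> letters and then \<open>\<sigma>\<close> to its last \<open>l\<close> letters gives \<open>\<tau>(j) \<sigma>\<tau>(u) \<sigma>(j)\<close>; the other order
  gives \<open>\<tau>(j) \<tau>\<sigma>(u) \<sigma>(j)\<close>.  After cancelling both ends, \<open>\<sigma>\<tau>(u)\<close> and \<open>\<tau>\<sigma>(u)\<close> are congruent words of
  length \<open>l - 1\<close>, hence equal.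
\<close>

lemma cancel_imp_commute:
  assumes cancel: "monoid_cancel (S_monoid n l H)" and "2 \<le> l"
    and \<sigma>: "\<sigma> \<in> H" "\<sigma> ` {1..n} \<subseteq> {1..n}"
    and \<tau>: "\<tau> \<in> H" "\<tau> ` {1..n} \<subseteq> {1..n}"
    and "j \<in> {1..n}"
  shows "\<sigma> (\<tau> j) = \<tau> (\<sigma> j)"
proof -
  let ?u = "replicate (l - 1) j" and ?cong = "pres_cong {1..n} (S_relations n l H)"
  have l: "Suc (l - Suc 0) = l" using \<open>2 \<le> l\<close> by simp
  have mem: "j \<in> {1..n}" "\<sigma> j \<in> {1..n}" "\<tau> j \<in> {1..n}"
    using \<open>j \<in> {1..n}\<close> \<sigma>(2) \<tau>(2) by (auto simp del: atLeastAtMost_iff)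
  have words: "?u \<in> lists {1..n}" "map \<sigma> ?u \<in> lists {1..n}" "map \<tau> ?u \<in> lists {1..n}"
    using mem by (simp_all add: in_lists_conv_set)
  have "([j] @ ?u @ [j], [\<tau> j] @ map \<tau> ?u @ [j]) \<in> ?cong"
    using pres_cong_window[OF \<tau>, of "[]" "j # ?u" "[j]" l] words mem l by simp
  moreover have "([\<tau> j] @ map \<tau> ?u @ [j], [\<tau> j] @ map \<sigma> (map \<tau> ?u) @ [\<sigma> j]) \<in> ?cong"
    using pres_cong_window[OF \<sigma>, of "[\<tau> j]" "map \<tau> ?u @ [j]" "[]" l] words mem l by simp
  moreover have "([j] @ ?u @ [j], [j] @ map \<sigma> ?u @ [\<sigma> j]) \<in> ?cong"
    using pres_cong_window[OF \<sigma>, of "[j]" "?u @ [j]" "[]" l] words mem l by simp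
  moreover have "([j] @ map \<sigma> ?u @ [\<sigma> j], [\<tau> j] @ map \<tau> (map \<sigma> ?u) @ [\<sigma> j]) \<in> ?cong"
    using pres_cong_window[OF \<tau>, of "[]" "j # map \<sigma> ?u" "[\<sigma> j]" l] words mem l by simp
  ultimately have
    "([\<tau> j] @ map \<sigma> (map \<tau> ?u) @ [\<sigma> j], [\<tau> j] @ map \<tau> (map \<sigma> ?u) @ [\<sigma> j]) \<in> ?cong"
    by (meson pres_cong.sym pres_cong.trans)
  then have "(map \<sigma> (map \<tau> ?u) @ [\<sigma> j], map \<tau> (map \<sigma> ?u) @ [\<sigma> j]) \<in> ?cong"
    by (rule presented_monoid_cancelD(1)[OF cancel[unfolded S_monoid_def]])
  then have "(map \<sigma> (map \<tau> ?u), map \<tau> (map \<sigma> ?u)) \<in> ?cong"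
    by (rule presented_monoid_cancelD(2)[OF cancel[unfolded S_monoid_def]])
  from pres_cong_short[OF this S_relations_length]
  have "map \<sigma> (map \<tau> ?u) = map \<tau> (map \<sigma> ?u)" using \<open>2 \<le> l\<close> by simp
  then show ?thesis using \<open>2 \<le> l\<close> by simp
qed

section \<open>The characterization\<close>

theorem theorem2p3:
  fixes n l :: nat and H :: "(nat \<Rightarrow> nat) set"
  assumes "n \<ge> 1" and "l \<ge> 2" and "subgroup H (sym_group n)"
  shows "monoid_cancel (S_monoid n l H) \<longleftrightarrow>
           semi_regular n H \<and> comm_group ((sym_group n)\<lparr>carrier := H\<rparr>)"
proof -
  let ?G = "(sym_group n)\<lparr>carrier := H\<rparr>"
  have group: "group ?G"
    using assms(3) sym_group_is_group by (rule subgroup.subgroup_is_group)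
  have perm: "\<sigma> permutes {1..n}" if "\<sigma> \<in> H" for \<sigma>
    using subgroup.mem_carrier[OF assms(3) that] by (simp add: sym_group_def)
  then have maps: "\<sigma> ` {1..n} \<subseteq> {1..n}" if "\<sigma> \<in> H" for \<sigma>
    using that permutes_image by blast
  have id_mem: "id \<in> H"
    using subgroup.one_closed[OF assms(3)] by (simp add: sym_group_def)
  have perm_eqI: "\<sigma> = \<tau>" if "\<sigma> permutes {1..n}" "\<tau> permutes {1..n}"
      "\<And>j. j \<in> {1..n} \<Longrightarrow> \<sigma> j = \<tau> j" for \<sigma> \<tau>
    using that by (metis ext permutes_not_in)
  show ?thesis
  proof
    assume cancel: "monoid_cancel (S_monoid n l H)"
    have "\<sigma> = id" if "\<sigma> \<in> H" "i \<in> {1..n}" "\<sigma> i = i" for \<sigma> i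
      using fixed_point_imp_pointwise_fixed[OF cancel assms(2) that(1) maps[OF that(1)] that(2,3)]
      by (intro perm_eqI perm that(1) id_mem) simp
    then have "semi_regular n H"
      using id_mem unfolding semi_regular_def by auto
    moreover have "\<sigma> \<circ> \<tau> = \<tau> \<circ> \<sigma>" if "\<sigma> \<in> H" "\<tau> \<in> H" for \<sigma> \<tau>
      using cancel_imp_commute[OF cancel assms(2)] that maps
      by (intro perm_eqI permutes_compose perm that) simp
    then have "comm_group ?G"
      by (intro group.group_comm_groupI[OF group]) (simp add: sym_group_def)
    ultimately show "semi_regular n H \<and> comm_group ?G" ..
  next
    assume *: "semi_regular n H \<and> comm_group ?G"
    then interpret G: comm_group ?G by blast
    have bij: "abelian_bijections H l"
    proof
      fix \<sigma> \<tau> assume "\<sigma> \<in> H" "\<tau> \<in> H"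
      then show "\<sigma> \<circ> \<tau> \<in> H" "\<sigma> \<circ> \<tau> = \<tau> \<circ> \<sigma>"
        using G.m_closed[of \<sigma> \<tau>] G.m_comm[of \<sigma> \<tau>] by (simp_all add: sym_group_def)
    next
      fix \<sigma> assume "\<sigma> \<in> H"
      then show "\<exists>\<tau>\<in>H. \<tau> \<circ> \<sigma> = id"
        using G.l_inv_ex[of \<sigma>] by (simp add: sym_group_def)
    qed (use id_mem assms(2) in simp_all)
    have free: "\<sigma> = id" if "\<sigma> \<in> H" "i \<in> {1..n}" "\<sigma> i = i" for \<sigma> i
      using * that unfolding semi_regular_def by blast
    show "monoid_cancel (S_monoid n l H)"
      unfolding S_monoid_def monoid_cancel_presented_monoid_iff
    proof (intro ballI conjI impI)
      fix u v w
      show "(u, v) \<in> pres_cong {1..n} (S_relations n l H)"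
        if "(w @ u, w @ v) \<in> pres_cong {1..n} (S_relations n l H)"
        by (rule pres_cong_left_cancel[OF bij _ _ that]) (erule maps, rule free)
      show "(u, v) \<in> pres_cong {1..n} (S_relations n l H)"
        if "(u @ w, v @ w) \<in> pres_cong {1..n} (S_relations n l H)"
        by (rule pres_cong_right_cancel[OF bij _ _ that]) (erule maps, rule free)
    qed
  qed
qed

end
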